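(* Let $\Omega\subset\mathbb{C}\setminus\{0\}$ be open, let $V,W\subset L^2$ be closed subspaces and let $(T(z))_{z\in\Omega}\subset\mathcal{L}(V,W)$ satisfy $L^2$-$L^p$ decay estimates of order $\nu>d$ for some $p\in[2,\infty]$. Then there exists $C>0$ such that for all $z\in\Omega$ and $f\in V\cap L^p$ we have $$\|T(z)f\|_{L^p}\le C\|f\|_{L^p}.$$
   Context: Here $d\ge2$ is the dimension, and $L^p$ denotes $L^p(\mathbb{R}^d;X)$ with target space $X\in\{\mathbb{C},\mathbb{C}^d,\mathbb{C}^{d\times d}\}$ (the targets for $V$ and $W$ may differ). $\mathcal{L}(V,W)$ denotes the bounded linear operators. For an open ball $B=B(x,r)$ put $B_n=B(x,2^nr)$, $C_0(B)=B$, $C_n(B)=B_n\setminus\overline{B_{n-1}}$ for $n\ge1$. Definition ($L^2$-$L^p$ decay estimates): $(T(z))_{z\in\Omega}\subset\mathcal{L}(V,W)$ satisfies $L^2$-$L^p$ decay estimates of order $\nu\ge0$ for $p\in[2,\infty]$ if there exist $M,N\ge0$ and a constant $C>0$ such that $$\|T(z)f\|_{L^p(B)}\le C\,r^{-d(\frac12-\frac1p)}\max\Big\{\Big(\frac{r^2}{|z|}\Big)^M,\Big(\frac{r^2}{|z|}\Big)^{-N}\Big\}\bigg(\sum_{n=0}^\infty2^{-\nu n}\|f\|_{L^2(C_n(B))}^2\bigg)^{\frac12}$$ for all $z\in\Omega$, all balls $B=B(x,r)\subset\mathbb{R}^d$ and all $f\in V$. *)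

theory Defs
  imports "HOL-Analysis.Analysis" "HOL-Probability.Essential_Supremum"
begin

text \<open>The admissible target spaces \<open>\<complex>\<close>, \<open>\<complex>\<^sup>d\<close>, \<open>\<complex>\<^bsup>d\<times>d\<^esup>\<close> are
  captured by a class of finite-dimensional complex Euclidean spaces; the instances below make
  \<open>complex\<close>, \<open>complex ^ 'd\<close> and \<open>complex ^ 'd ^ 'd\<close> members of it.  The pointwise norm is the
  modulus, the Euclidean norm and the Frobenius norm, respectively.\<close>

class complex_euclidean_space = euclidean_space +
  fixes scaleC :: "complex \<Rightarrow> 'a \<Rightarrow> 'a"  (infixr "*\<^sub>C" 75)
  assumes scaleC_add_right: "c *\<^sub>C (x + y) = c *\<^sub>C x + c *\<^sub>C y"
    and scaleC_add_left: "(b + c) *\<^sub>C x = b *\<^sub>C x + c *\<^sub>C x"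
    and scaleC_scaleC: "b *\<^sub>C c *\<^sub>C x = (b * c) *\<^sub>C x"
    and scaleC_of_real: "complex_of_real r *\<^sub>C x = r *\<^sub>R x"
    and norm_scaleC: "norm (c *\<^sub>C x) = cmod c * norm x"

instantiation complex :: complex_euclidean_space
begin

definition scaleC_complex :: "complex \<Rightarrow> complex \<Rightarrow> complex"
  where "scaleC_complex c x = c * x"

instance
  by standard
    (simp_all add: scaleC_complex_def algebra_simps norm_mult scaleR_conv_of_real)

end

instantiation vec :: (complex_euclidean_space, finite) complex_euclidean_space
begin

definition scaleC_vec :: "complex \<Rightarrow> 'a ^ 'b \<Rightarrow> 'a ^ 'b"
  where "scaleC_vec c x = (\<chi> i. c *\<^sub>C (x $ i))"

instance
proof
  fix c :: complex and x :: "'a ^ 'b"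
  show "norm (c *\<^sub>C x) = cmod c * norm x"
    by (simp add: scaleC_vec_def norm_vec_def norm_scaleC L2_set_right_distrib)
qed (simp_all add: scaleC_vec_def vec_eq_iff scaleC_add_right scaleC_add_left
       scaleC_scaleC scaleC_of_real)

end

text \<open>Positive real powers in \<open>[0,\<infinity>]\<close>; only used for exponents \<open>a > 0\<close>.\<close>

definition ennpowr :: "ennreal \<Rightarrow> real \<Rightarrow> ennreal"
  where "ennpowr t a = (if t = \<infinity> then \<infinity> else ennreal (enn2real t powr a))"

text \<open>The \<open>L\<^sup>p(A)\<close>-norm, for \<open>p \<in> [1,\<infinity>]\<close>, of a function measurable on \<open>A\<close>, with values in
  \<open>[0,\<infinity>]\<close>.  An inequality \<open>Lp_norm p A f \<le> K\<close> with \<open>K < \<infinity>\<close> thus includes the assertion that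
  \<open>f\<close> is in \<open>L\<^sup>p(A)\<close>.\<close>

definition Lp_norm :: "ennreal \<Rightarrow> (real ^ 'd) set \<Rightarrow> (real ^ 'd \<Rightarrow> 'x::euclidean_space) \<Rightarrow> ennreal"
  where "Lp_norm p A f =
    (if p = \<infinity> then esssup (lebesgue_on A) (\<lambda>x. ennreal (norm (f x)))
     else ennpowr (\<integral>\<^sup>+x. ennreal (norm (f x) powr enn2real p) \<partial>lebesgue_on A)
            (1 / enn2real p))"

text \<open>Elements of \<open>L\<^sup>p(\<real>\<^sup>d)\<close> are represented by Lebesgue-measurable functions; no quotient by
  almost everywhere equality is taken.\<close>

definition Lp_space :: "ennreal \<Rightarrow> (real ^ 'd \<Rightarrow> 'x::euclidean_space) set"
  where "Lp_space p = {f \<in> borel_measurable lebesgue. Lp_norm p UNIV f < \<infinity>}"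

text \<open>Closed complex-linear subspaces of \<open>L\<^sup>2(\<real>\<^sup>d)\<close>.  Constant sequences in the last clause show
  that such a \<open>V\<close> is saturated under almost everywhere equality, so it is the preimage of a
  closed subspace of the space of equivalence classes.\<close>

definition closed_L2_subspace :: "(real ^ 'd \<Rightarrow> 'x::complex_euclidean_space) set \<Rightarrow> bool"
  where "closed_L2_subspace V \<longleftrightarrow>
    V \<subseteq> Lp_space 2 \<and>
    (\<lambda>x. 0) \<in> V \<and>
    (\<forall>f\<in>V. \<forall>g\<in>V. (\<lambda>x. f x + g x) \<in> V) \<and>
    (\<forall>c. \<forall>f\<in>V. (\<lambda>x. c *\<^sub>C f x) \<in> V) \<and>
    (\<forall>u g. (\<forall>n::nat. u n \<in> V) \<and> g \<in> Lp_space 2 \<and>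
        (\<lambda>n. Lp_norm 2 UNIV (\<lambda>x. u n x - g x)) \<longlonglongrightarrow> 0 \<longrightarrow> g \<in> V)"

text \<open>Bounded complex-linear operators from \<open>V\<close> to \<open>W\<close>.  Linearity is an identity in \<open>L\<^sup>2\<close>, hence
  holds almost everywhere.  Linearity and boundedness together force \<open>S\<close> to map almost everywhere
  equal functions to almost everywhere equal functions, so that \<open>S\<close> descends to classes.\<close>

definition bounded_operators ::
  "(real ^ 'd \<Rightarrow> 'x::complex_euclidean_space) set \<Rightarrow> (real ^ 'd \<Rightarrow> 'y::complex_euclidean_space) set
    \<Rightarrow> ((real ^ 'd \<Rightarrow> 'x) \<Rightarrow> (real ^ 'd \<Rightarrow> 'y)) set"
  where "bounded_operators V W = {S.
    (\<forall>f\<in>V. S f \<in> W) \<and>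
    (\<forall>f\<in>V. \<forall>g\<in>V. AE x in lebesgue. S (\<lambda>y. f y + g y) x = S f x + S g x) \<and>
    (\<forall>c. \<forall>f\<in>V. AE x in lebesgue. S (\<lambda>y. c *\<^sub>C f y) x = c *\<^sub>C S f x) \<and>
    (\<exists>K::real. \<forall>f\<in>V. Lp_norm 2 UNIV (S f) \<le> ennreal K * Lp_norm 2 UNIV f)}"

definition dyadic_annulus :: "nat \<Rightarrow> real ^ 'd \<Rightarrow> real \<Rightarrow> (real ^ 'd) set"
  where "dyadic_annulus n x r =
    (if n = 0 then ball x r else ball x (2 ^ n * r) - closure (ball x (2 ^ (n - 1) * r)))"

text \<open>Since \<open>enn2real (inverse \<infinity>) = 0\<close>, the term \<open>enn2real (inverse p)\<close> is \<open>1/p\<close> with the usual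
  convention \<open>1/\<infinity> = 0\<close>.\<close>

definition L2_Lp_decay_estimates ::
  "real \<Rightarrow> ennreal \<Rightarrow> complex set \<Rightarrow> (real ^ 'd \<Rightarrow> 'x::complex_euclidean_space) set
    \<Rightarrow> (complex \<Rightarrow> (real ^ 'd \<Rightarrow> 'x) \<Rightarrow> (real ^ 'd \<Rightarrow> 'y::complex_euclidean_space)) \<Rightarrow> bool"
  where "L2_Lp_decay_estimates \<nu> p \<Omega> V T \<longleftrightarrow>
    (\<exists>M N C :: real. 0 \<le> M \<and> 0 \<le> N \<and> 0 < C \<and>
      (\<forall>z\<in>\<Omega>. \<forall>x r. 0 < r \<longrightarrow> (\<forall>f\<in>V.
        Lp_norm p (ball x r) (T z f) \<le>
          ennreal (C * r powr (- real CARD('d) * (1 / 2 - enn2real (inverse p)))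
            * max ((r\<^sup>2 / cmod z) powr M) ((r\<^sup>2 / cmod z) powr (- N)))
          * ennpowr (\<Sum>n. ennreal (2 powr (- \<nu> * real n))
                        * (Lp_norm 2 (dyadic_annulus n x r) f)\<^sup>2) (1 / 2))))"

end

theory Submission
  imports Defs
begin

text \<open>
  Tested on balls of the parabolic radius \<open>r = \<surd>|z|\<close>, the factor
  \<open>max ((r\<^sup>2/|z|)\<^sup>M) ((r\<^sup>2/|z|)\<^bsup>-N\<^esup>)\<close> equals \<open>1\<close>.
  The sum over the annuli around \<open>x\<close> is dominated by the convolution \<open>\<integral>k(|x-y|) |f(y)|\<^sup>2 dy\<close> with
  the radial kernel \<open>k(t) = \<Sum>\<^sub>n 2\<^bsup>-\<nu>n\<^esup> 1[t < 2\<^sup>n r]\<close>, obtained by enlarging each annulus to the ball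
  that it lies in.  This is where \<open>\<nu> > d\<close> enters: the mass of \<open>k\<close> is
  \<open>\<Sum>\<^sub>n 2\<^bsup>-\<nu>n\<^esup> |B(0,2\<^sup>n r)| = |B(0,r)| \<Sum>\<^sub>n 2\<^bsup>(d-\<nu>)n\<^esup>\<close>, a geometric series
  (\<open>nn_integral_decay_kernel\<close>).

  For \<open>p < \<infinity>\<close> the local estimates are integrated over all centres \<open>x\<close>, which replaces a covering
  of the space by balls with controlled overlap.  On the left this gives
  \<open>|B(0,r)| \<parallel>T(z)f\<parallel>\<^sub>p\<^sup>p\<close>; on the right, Jensen's inequality for the kernel
  (\<open>weighted_power_mean_nn_integral\<close>) moves the power \<open>p/2\<close> from the convolution to \<open>|f|\<^sup>2\<close>, and
  Tonelli's theorem (\<open>nn_integral_radial_kernel\<close>) yields a multiple of \<open>\<parallel>f\<parallel>\<^sub>p\<^sup>p\<close>.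
  For \<open>p = \<infinity>\<close> the convolution is at most the mass of \<open>k\<close> times \<open>\<parallel>f\<parallel>\<^sub>\<infinity>\<^sup>2\<close>, and countably many balls
  cover the space.

  All powers of \<open>r\<close> cancel, because \<open>k\<close> has mass \<open>r\<^sup>d\<close> up to a constant and the local estimates
  carry the scaling factor \<open>r\<^bsup>-d(1/2-1/p)\<^esup>\<close>.  So the constant does not depend on \<open>z\<close>.
\<close>

section \<open>Powers of extended nonnegative numbers\<close>

lemma ennpowr_ennreal: "0 \<le> x \<Longrightarrow> ennpowr (ennreal x) a = ennreal (x powr a)"
  by (simp add: ennpowr_def)

lemma ennpowr_top [simp]: "ennpowr \<infinity> a = \<infinity>" "ennpowr top a = top"
  by (simp_all add: ennpowr_def)

lemma ennpowr_mono:
  assumes "0 \<le> a" "s \<le> t"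
  shows "ennpowr s a \<le> ennpowr t a"
proof (cases "t = \<infinity>")
  case False
  then have "s \<noteq> \<infinity>"
    using assms(2) by (auto simp: top_unique)
  moreover have "enn2real s \<le> enn2real t"
    using False assms(2) by (intro enn2real_mono) (auto simp: less_top)
  ultimately show ?thesis
    using False assms(1) by (auto simp: ennpowr_def intro!: ennreal_leI powr_mono2)
qed simp

lemma ennpowr_ennpowr: "ennpowr (ennpowr t a) b = ennpowr t (a * b)"
  by (cases t) (auto simp: ennpowr_ennreal powr_powr)

lemma ennpowr_one [simp]: "ennpowr t 1 = t"
  by (cases t) (auto simp: ennpowr_ennreal)

lemma ennpowr_mult:
  assumes "0 \<le> c"
  shows "ennpowr (ennreal c * t) a = ennreal (c powr a) * ennpowr t a"
proof (cases t)
  case (real x)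
  with assms show ?thesis
    by (simp add: ennpowr_ennreal powr_mult flip: ennreal_mult)
next
  case top
  then show ?thesis
    using assms by (cases "c = 0") (auto simp: ennreal_mult_top ennpowr_def)
qed

lemma ennpowr_half_square: "(ennpowr t (1 / 2))\<^sup>2 = t"
proof (cases t)
  case (real x)
  then have "(x powr (1 / 2))\<^sup>2 = x"
    by (simp add: powr_half_sqrt)
  with real show ?thesis
    by (simp add: ennpowr_ennreal ennreal_power)
qed (simp add: power2_eq_square)

section \<open>Jensen's inequality with weights\<close>

text \<open>The Hoelder or Jensen inequality for the convex function \<open>t \<mapsto> t\<^sup>q\<close> and the weight \<open>w\<close>.
  Young's inequality bounds \<open>s\<^bsup>q-1\<^esup> g\<close> by \<open>g\<^sup>q / q + (1 - 1/q) s\<^sup>q\<close>, which says that the graph of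
  \<open>t \<mapsto> t\<^sup>q\<close> lies above its tangent at \<open>s\<close>; integrating this
  against \<open>w\<close> and taking for \<open>s\<close> the quotient of \<open>\<integral>w g\<close> by the bound \<open>K\<close> of the mass proves the claim.\<close>

lemma weighted_power_mean_nn_integral:
  fixes w :: "'a \<Rightarrow> ennreal" and g :: "'a \<Rightarrow> real"
  assumes [measurable]: "w \<in> borel_measurable M" "g \<in> borel_measurable M"
    and g: "\<And>x. 0 \<le> g x"
    and K: "0 < K" "(\<integral>\<^sup>+x. w x \<partial>M) \<le> ennreal K"
    and q: "1 \<le> q"
  shows "ennpowr (\<integral>\<^sup>+x. w x * ennreal (g x) \<partial>M) q
    \<le> ennreal (K powr (q - 1)) * (\<integral>\<^sup>+x. w x * ennreal (g x powr q) \<partial>M)"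
proof -
  let ?A = "\<integral>\<^sup>+x. w x * ennreal (g x) \<partial>M" and ?B = "\<integral>\<^sup>+x. w x * ennreal (g x powr q) \<partial>M"
  have young: "ennreal (s powr (q - 1)) * ?A \<le> ennreal (1 / q) * ?B + ennreal ((1 - 1 / q) * s powr q * K)"
    if s: "0 \<le> s" for s
  proof -
    have pointwise: "s powr (q - 1) * t \<le> (1 / q) * t powr q + (1 - 1 / q) * s powr q"
      if t: "0 \<le> t" for t
    proof (cases "s = 0 \<or> t = 0")
      case True
      then show ?thesis
        using s t q by auto
    next
      case False
      then show ?thesis
        using Youngs_inequality_0[of "1 / q" "1 - 1 / q" "t powr q" "s powr q"] s t q
        by (simp add: powr_powr algebra_simps)
    qed
    have "ennreal (s powr (q - 1)) * ?A = (\<integral>\<^sup>+x. ennreal (s powr (q - 1)) * (w x * ennreal (g x)) \<partial>M)"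
      by (simp add: nn_integral_cmult)
    also have "\<dots> = (\<integral>\<^sup>+x. w x * ennreal (s powr (q - 1) * g x) \<partial>M)"
      using g by (intro nn_integral_cong) (simp add: ennreal_mult mult_ac)
    also have "\<dots> \<le> (\<integral>\<^sup>+x. w x * ennreal ((1 / q) * g x powr q + (1 - 1 / q) * s powr q) \<partial>M)"
      by (intro nn_integral_mono mult_left_mono ennreal_leI pointwise g) auto
    also have "\<dots> = (\<integral>\<^sup>+x. ennreal (1 / q) * (w x * ennreal (g x powr q))
        + ennreal ((1 - 1 / q) * s powr q) * w x \<partial>M)"
      using q by (intro nn_integral_cong)
        (simp add: ennreal_plus ennreal_mult distrib_left mult_ac del: times_divide_eq_left)
    also have "\<dots> = ennreal (1 / q) * ?B + ennreal ((1 - 1 / q) * s powr q) * (\<integral>\<^sup>+x. w x \<partial>M)"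
      by (simp add: nn_integral_add nn_integral_cmult)
    also have "\<dots> \<le> ennreal (1 / q) * ?B + ennreal ((1 - 1 / q) * s powr q) * ennreal K"
      by (intro add_left_mono mult_left_mono K) auto
    finally show ?thesis
      using K q by (simp add: ennreal_mult)
  qed
  show ?thesis
  proof (cases "?B")
    case top
    then show ?thesis
      using K(1) by (simp add: ennreal_mult_top)
  next
    case (real b)
    \<comment> \<open>The tangent at \<open>1\<close> already shows that \<open>\<integral>w g\<close> is finite, so that it can be used to
      define the optimal tangent point.\<close>
    have "?A \<le> ennreal (1 / q) * ?B + ennreal ((1 - 1 / q) * K)"
      using young[of 1] by simp
    also have "\<dots> < \<infinity>"
      using real by (simp add: ennreal_mult_less_top)
    finally have "?A < \<infinity>" .
    then obtain a where a: "0 \<le> a" "?A = ennreal a"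
      by (cases ?A) auto
    define s where "s = a / K"
    have s: "0 \<le> s" "a = K * s"
      using K a by (simp_all add: s_def)
    have "ennreal (s powr (q - 1) * a) \<le> ennreal ((1 / q) * b + (1 - 1 / q) * s powr q * K)"
      using young[OF s(1)] a real q K
      by (simp add: ennreal_plus ennreal_mult del: times_divide_eq_left)
    then have le: "s powr (q - 1) * a \<le> (1 / q) * b + (1 - 1 / q) * s powr q * K"
      using q K real by (subst (asm) ennreal_le_iff) auto
    have "s powr (q - 1) * a = s powr q * K"
      using s by (cases "s = 0") (simp_all add: powr_diff)
    with le have "s powr q * K / q \<le> b / q"
      by (simp add: algebra_simps)
    then have "s powr q * K \<le> b"
      using q by (simp add: divide_le_cancel)
    then have "K powr (q - 1) * (s powr q * K) \<le> K powr (q - 1) * b"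
      by (intro mult_left_mono) auto
    moreover have "K powr (q - 1) * (s powr q * K) = a powr q"
      using s K by (simp add: powr_mult powr_diff)
    ultimately show ?thesis
      using a real by (simp add: ennpowr_ennreal flip: ennreal_mult)
  qed
qed

section \<open>Radial kernels\<close>

lemma nn_integral_radial_translate:
  fixes k :: "real \<Rightarrow> ennreal" and x :: "'a::euclidean_space"
  assumes [measurable]: "k \<in> borel_measurable borel"
  shows "(\<integral>\<^sup>+y. k (dist x y) \<partial>lborel) = (\<integral>\<^sup>+y. k (norm y) \<partial>(lborel :: 'a measure))"
proof -
  have "(\<integral>\<^sup>+y. k (dist x y) \<partial>lborel) = (\<integral>\<^sup>+y. k (dist x y) \<partial>distr lborel borel ((+) x))"
    by (simp add: lborel_distr_plus)
  also have "\<dots> = (\<integral>\<^sup>+y. k (norm y) \<partial>(lborel :: 'a measure))"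
    by (subst nn_integral_distr) (auto simp: dist_norm)
  finally show ?thesis .
qed

text \<open>Tonelli's theorem.  It is applied to a Borel representative of \<open>g\<close>, since the Lebesgue measure
  on the product space is not the product of the Lebesgue measures but its completion.\<close>

lemma nn_integral_radial_kernel:
  fixes k :: "real \<Rightarrow> ennreal" and g :: "'a::euclidean_space \<Rightarrow> ennreal"
  assumes [measurable]: "k \<in> borel_measurable borel" and g: "g \<in> borel_measurable lebesgue"
  shows "(\<integral>\<^sup>+x. (\<integral>\<^sup>+y. k (dist x y) * g y \<partial>lebesgue) \<partial>lebesgue)
    = (\<integral>\<^sup>+x. k (norm x) \<partial>(lborel :: 'a measure)) * (\<integral>\<^sup>+y. g y \<partial>lebesgue)"
proof -
  obtain h where [measurable]: "h \<in> borel_measurable lborel" and h: "AE x in lborel. g x = h x"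
    using completion_ex_borel_measurable[OF g] by auto
  have "(\<integral>\<^sup>+x. (\<integral>\<^sup>+y. k (dist x y) * g y \<partial>lebesgue) \<partial>lebesgue)
      = (\<integral>\<^sup>+x. (\<integral>\<^sup>+y. k (dist x y) * h y \<partial>lborel) \<partial>lborel)"
    unfolding nn_integral_completion
    by (intro nn_integral_cong nn_integral_cong_AE) (use h in auto)
  also have "\<dots> = (\<integral>\<^sup>+y. (\<integral>\<^sup>+x. k (dist x y) * h y \<partial>lborel) \<partial>lborel)"
    by (rule lborel_pair.Fubini'[symmetric]) measurable
  also have "\<dots> = (\<integral>\<^sup>+y. (\<integral>\<^sup>+x. k (norm x) \<partial>(lborel :: 'a measure)) * h y \<partial>lborel)"
    by (intro nn_integral_cong)
      (simp add: nn_integral_multc dist_commute[of _ "_ :: 'a"] nn_integral_radial_translate)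
  also have "\<dots> = (\<integral>\<^sup>+x. k (norm x) \<partial>(lborel :: 'a measure)) * (\<integral>\<^sup>+y. h y \<partial>lborel)"
    by (simp add: nn_integral_cmult)
  also have "(\<integral>\<^sup>+y. h y \<partial>lborel) = (\<integral>\<^sup>+y. g y \<partial>lebesgue)"
    unfolding nn_integral_completion by (intro nn_integral_cong_AE) (use h in auto)
  finally show ?thesis .
qed

text \<open>Full balls instead of annuli make the kernel larger by a constant factor only, and its mass
  becomes an exact geometric series.\<close>

definition decay_kernel :: "real \<Rightarrow> real \<Rightarrow> real \<Rightarrow> ennreal"
  where "decay_kernel \<nu> r t =
    (\<Sum>n. ennreal (2 powr (- \<nu> * real n)) * indicator {..<2 ^ n * r} t)"

lemma decay_kernel_measurable [measurable]: "decay_kernel \<nu> r \<in> borel_measurable borel"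
  unfolding decay_kernel_def by measurable

lemma nn_integral_decay_kernel:
  assumes "real DIM('a) < \<nu>" "0 < r"
  shows "(\<integral>\<^sup>+x. decay_kernel \<nu> r (norm x) \<partial>(lborel :: 'a::euclidean_space measure))
    = ennreal (unit_ball_vol (real DIM('a)) * r ^ DIM('a) * (1 / (1 - 2 powr (real DIM('a) - \<nu>))))"
proof -
  let ?d = "DIM('a)" and ?v = "unit_ball_vol (real DIM('a))"
  have v: "0 \<le> ?v"
    by (simp add: unit_ball_vol_nonneg)
  have ratio: "2 powr (real ?d - \<nu>) < 1"
    using assms using powr_less_cancel_iff[of 2 "real ?d - \<nu>" 0] by simp
  have "(\<integral>\<^sup>+x. decay_kernel \<nu> r (norm x) \<partial>(lborel :: 'a measure))
      = (\<Sum>n. ennreal (2 powr (- \<nu> * real n)) * emeasure lborel (ball (0 :: 'a) (2 ^ n * r)))"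
  proof -
    have "(\<integral>\<^sup>+x. ennreal (2 powr (- \<nu> * real n)) * indicator {..<2 ^ n * r} (norm x) \<partial>(lborel :: 'a measure))
        = ennreal (2 powr (- \<nu> * real n)) * emeasure lborel (ball (0 :: 'a) (2 ^ n * r))" for n
    proof -
      have "(\<lambda>x::'a. ennreal (2 powr (- \<nu> * real n)) * indicator {..<2 ^ n * r} (norm x))
          = (\<lambda>x. ennreal (2 powr (- \<nu> * real n)) * indicator (ball 0 (2 ^ n * r)) x)"
        by (auto simp: fun_eq_iff indicator_def)
      then show ?thesis
        by (simp only:) (rule nn_integral_cmult_indicator, simp)
    qed
    then show ?thesis
      unfolding decay_kernel_def by (subst nn_integral_suminf) simp_all
  qed
  also have "\<dots> = (\<Sum>n. ennreal (?v * r ^ ?d * (2 powr (real ?d - \<nu>)) ^ n))"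
  proof (intro suminf_cong)
    fix n
    have "2 powr (- \<nu> * real n) * (2 ^ n) ^ ?d = (2 powr (real ?d - \<nu>)) ^ n"
    proof -
      have "(2 powr (real ?d - \<nu>)) ^ n = (2::real) powr (- \<nu> * real n) * 2 powr (real n * real ?d)"
        by (simp add: powr_realpow[symmetric] powr_powr powr_add[symmetric] algebra_simps)
      also have "(2::real) powr (real n * real ?d) = (2 ^ n) ^ ?d"
        by (simp add: powr_realpow[symmetric] powr_powr)
      finally show ?thesis ..
    qed
    moreover have "ennreal (2 powr (- \<nu> * real n)) * emeasure lborel (ball (0 :: 'a) (2 ^ n * r))
        = ennreal (?v * r ^ ?d * (2 powr (- \<nu> * real n) * (2 ^ n) ^ ?d))"
      using assms(2) v by (simp add: emeasure_ball power_mult_distrib mult_ac flip: ennreal_mult)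
    ultimately show "ennreal (2 powr (- \<nu> * real n)) * emeasure lborel (ball (0 :: 'a) (2 ^ n * r))
        = ennreal (?v * r ^ ?d * (2 powr (real ?d - \<nu>)) ^ n)"
      by simp
  qed
  also have "\<dots> = ennreal (?v * r ^ ?d * (1 / (1 - 2 powr (real ?d - \<nu>))))"
  proof (rule suminf_ennreal_eq)
    show "(\<lambda>n. ?v * r ^ ?d * (2 powr (real ?d - \<nu>)) ^ n) sums
        (?v * r ^ ?d * (1 / (1 - 2 powr (real ?d - \<nu>))))"
      using ratio by (intro sums_mult geometric_sums) simp
  qed (use v assms(2) in simp)
  finally show ?thesis .
qed

section \<open>Norms as integrals against kernels\<close>

lemma Lp_norm_finite_exponent:
  fixes f :: "real ^ 'd \<Rightarrow> 'x::euclidean_space"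
  assumes "p \<noteq> \<infinity>" "A \<in> sets lebesgue"
  shows "Lp_norm p A f = ennpowr (\<integral>\<^sup>+y. indicator A y * ennreal (norm (f y) powr enn2real p) \<partial>lebesgue)
    (1 / enn2real p)"
  using assms by (simp add: Lp_norm_def nn_integral_restrict_space mult.commute)

lemma Lp_norm_2_square:
  fixes f :: "real ^ 'd \<Rightarrow> 'x::euclidean_space"
  assumes "A \<in> sets lebesgue"
  shows "(Lp_norm 2 A f)\<^sup>2 = (\<integral>\<^sup>+y. indicator A y * ennreal ((norm (f y))\<^sup>2) \<partial>lebesgue)"
  using assms by (simp add: Lp_norm_finite_exponent ennpowr_half_square)

lemma sum_dyadic_annuli_le_decay_kernel:
  fixes f :: "real ^ 'd \<Rightarrow> 'x::euclidean_space"
  assumes f [measurable]: "f \<in> borel_measurable lebesgue"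
  shows "(\<Sum>n. ennreal (2 powr (- \<nu> * real n)) * (Lp_norm 2 (dyadic_annulus n x r) f)\<^sup>2)
    \<le> (\<integral>\<^sup>+y. decay_kernel \<nu> r (dist x y) * ennreal ((norm (f y))\<^sup>2) \<partial>lebesgue)"
proof -
  have sets [measurable]: "dyadic_annulus n x r \<in> sets lebesgue" "ball x (2 ^ n * r) \<in> sets lebesgue" for n
    by (auto simp: dyadic_annulus_def)
  have ind: "indicator {..<2 ^ n * r} (dist x y) = (indicator (ball x (2 ^ n * r)) y :: ennreal)" for n y
    by (auto simp: indicator_def)
  have "(\<Sum>n. ennreal (2 powr (- \<nu> * real n)) * (Lp_norm 2 (dyadic_annulus n x r) f)\<^sup>2)
      \<le> (\<Sum>n. ennreal (2 powr (- \<nu> * real n)) *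
          (\<integral>\<^sup>+y. indicator (ball x (2 ^ n * r)) y * ennreal ((norm (f y))\<^sup>2) \<partial>lebesgue))"
    unfolding Lp_norm_2_square[OF sets(1)]
    by (intro suminf_le mult_left_mono nn_integral_mono mult_right_mono summableI)
      (auto simp: indicator_def dyadic_annulus_def split: if_splits)
  also have "\<dots> = (\<integral>\<^sup>+y. decay_kernel \<nu> r (dist x y) * ennreal ((norm (f y))\<^sup>2) \<partial>lebesgue)"
    by (simp add: decay_kernel_def ind nn_integral_suminf mult.assoc
        flip: nn_integral_cmult ennreal_suminf_multc)
  finally show ?thesis .
qed


section \<open>From local to global bounds\<close>

text \<open>Integrating the \<open>p\<close>-th power of the local bound over the centre \<open>x\<close> counts each point of
  \<open>g\<close> with the volume \<open>c\<close> of a ball and each point of \<open>f\<close> with the mass \<open>c \<kappa>\<close> of the kernel.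
  The ratio \<open>\<kappa>\<close> of the two is the source of the factor \<open>\<kappa>\<^bsup>1/p\<^esup>\<close>; the power \<open>1/2 - 1/p\<close>
  of the mass comes from Jensen's inequality.\<close>

lemma Lp_bound_from_local_bounds_finite:
  fixes f :: "real ^ 'd \<Rightarrow> 'x::euclidean_space" and g :: "real ^ 'd \<Rightarrow> 'y::euclidean_space"
  assumes f [measurable]: "f \<in> borel_measurable lebesgue"
    and g [measurable]: "g \<in> borel_measurable lebesgue"
    and p: "2 \<le> p" "p \<noteq> \<infinity>" and D: "0 \<le> D"
    and c: "0 < c" and \<kappa>: "0 < \<kappa>"
    and k [measurable]: "k \<in> borel_measurable borel"
    and vol: "emeasure lborel (ball (0 :: real ^ 'd) r) = ennreal c"
    and mass: "(\<integral>\<^sup>+x. k (norm x) \<partial>(lborel :: (real ^ 'd) measure)) = ennreal (c * \<kappa>)"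
    and loc: "\<And>x. Lp_norm p (ball x r) g
      \<le> ennreal D * ennpowr (\<integral>\<^sup>+y. k (dist x y) * ennreal ((norm (f y))\<^sup>2) \<partial>lebesgue) (1 / 2)"
  shows "Lp_norm p UNIV g
    \<le> ennreal (D * (c * \<kappa>) powr (1 / 2 - enn2real (inverse p)) * \<kappa> powr (enn2real (inverse p)))
      * Lp_norm p UNIV f"
proof -
  define P where "P = enn2real p"
  have pP: "p = ennreal P"
    using p(2) by (simp add: P_def less_top)
  have P: "2 \<le> P"
  proof -
    have "ennreal 2 \<le> ennreal P"
      using p(1) pP by simp
    then show ?thesis
      by (subst (asm) ennreal_le_iff2) auto
  qed
  have inv: "enn2real (inverse p) = 1 / P"
    using P by (simp add: pP inverse_ennreal divide_inverse)
  have norm_UNIV: "Lp_norm p UNIV h = ennpowr (\<integral>\<^sup>+y. ennreal (norm (h y) powr P) \<partial>lebesgue) (1 / P)"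
    for h :: "real ^ 'd \<Rightarrow> 'z::euclidean_space"
    using p(2) by (simp add: Lp_norm_finite_exponent P_def)
  define B where "B = D powr P * (c * \<kappa>) powr (P / 2 - 1)"
  have B: "0 \<le> B"
    by (simp add: B_def)
  have radial [measurable]: "(\<lambda>y. k (dist x y)) \<in> borel_measurable lebesgue" for x :: "real ^ 'd"
    by (rule measurable_completion) measurable
  have ball: "(\<integral>\<^sup>+y. indicator {..<r} (dist x y) * ennreal (norm (g y) powr P) \<partial>lebesgue)
      \<le> (\<integral>\<^sup>+y. k (dist x y) * (ennreal B * ennreal (norm (f y) powr P)) \<partial>lebesgue)" for x
  proof -
    let ?I = "\<integral>\<^sup>+y. k (dist x y) * ennreal ((norm (f y))\<^sup>2) \<partial>lebesgue"
    let ?J = "\<integral>\<^sup>+y. k (dist x y) * ennreal (norm (f y) powr P) \<partial>lebesgue"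
    have square: "((norm (f y))\<^sup>2) powr (P / 2) = norm (f y) powr P" for y
    proof -
      have "(norm (f y))\<^sup>2 = norm (f y) powr 2"
        by simp
      then show ?thesis
        by (simp only: powr_powr) simp
    qed
    have mean: "ennpowr ?I (P / 2) \<le> ennreal ((c * \<kappa>) powr (P / 2 - 1)) * ?J"
    proof -
      have "(\<integral>\<^sup>+y. k (dist x y) \<partial>lebesgue) \<le> ennreal (c * \<kappa>)"
        by (simp add: nn_integral_completion nn_integral_radial_translate mass)
      then show ?thesis
        using weighted_power_mean_nn_integral[of "\<lambda>y. k (dist x y)" lebesgue "\<lambda>y. (norm (f y))\<^sup>2"
            "c * \<kappa>" "P / 2"] P c \<kappa>
        by (simp add: square)
    qed
    have ind: "indicator {..<r} (dist x y) = (indicator (ball x r) y :: ennreal)" for y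
      by (auto simp: indicator_def)
    have "(\<integral>\<^sup>+y. indicator {..<r} (dist x y) * ennreal (norm (g y) powr P) \<partial>lebesgue)
        = ennpowr (Lp_norm p (ball x r) g) P"
      using p(2) P by (simp add: Lp_norm_finite_exponent P_def ennpowr_ennpowr ind)
    also have "\<dots> \<le> ennpowr (ennreal D * ennpowr ?I (1 / 2)) P"
      using P loc by (intro ennpowr_mono) auto
    also have "\<dots> = ennreal (D powr P) * ennpowr ?I (P / 2)"
      using D by (simp add: ennpowr_mult ennpowr_ennpowr)
    also have "\<dots> \<le> ennreal (D powr P) * (ennreal ((c * \<kappa>) powr (P / 2 - 1)) * ?J)"
      using mean by (rule mult_left_mono) simp
    also have "\<dots> = ennreal B * ?J"
      by (simp add: B_def ennreal_mult mult.assoc)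
    also have "\<dots> = (\<integral>\<^sup>+y. ennreal B * (k (dist x y) * ennreal (norm (f y) powr P)) \<partial>lebesgue)"
      by (rule nn_integral_cmult[symmetric]) measurable
    finally show ?thesis
      by (simp add: mult.left_commute)
  qed
  let ?F = "\<integral>\<^sup>+y. ennreal (norm (f y) powr P) \<partial>lebesgue"
    and ?G = "\<integral>\<^sup>+y. ennreal (norm (g y) powr P) \<partial>lebesgue"
  \<comment> \<open>The indicator of a ball is itself a radial kernel, of mass \<open>c\<close>.\<close>
  have "ennreal c * ?G = (\<integral>\<^sup>+x. (\<integral>\<^sup>+y. indicator {..<r} (dist x y) * ennreal (norm (g y) powr P) \<partial>lebesgue) \<partial>lebesgue)"
  proof -
    have "(\<lambda>x. indicator {..<r} (norm x)) = (indicator (ball (0 :: real ^ 'd) r) :: _ \<Rightarrow> ennreal)"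
      by (auto simp: fun_eq_iff indicator_def)
    then show ?thesis
      by (subst nn_integral_radial_kernel) (simp_all add: vol)
  qed
  also have "\<dots> \<le> (\<integral>\<^sup>+x. (\<integral>\<^sup>+y. k (dist x y) * (ennreal B * ennreal (norm (f y) powr P)) \<partial>lebesgue) \<partial>lebesgue)"
    by (intro nn_integral_mono ball)
  also have "\<dots> = ennreal c * (ennreal (B * \<kappa>) * ?F)"
    using c \<kappa> B by (subst nn_integral_radial_kernel) (simp_all add: mass nn_integral_cmult ennreal_mult mult_ac)
  finally have "?G \<le> ennreal (B * \<kappa>) * ?F"
    using c by (subst (asm) ennreal_mult_le_mult_iff) auto
  then have "ennpowr ?G (1 / P) \<le> ennpowr (ennreal (B * \<kappa>) * ?F) (1 / P)"
    using P by (intro ennpowr_mono) auto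
  also have "\<dots> = ennreal ((B * \<kappa>) powr (1 / P)) * ennpowr ?F (1 / P)"
    using B \<kappa> by (intro ennpowr_mult) auto
  also have "(B * \<kappa>) powr (1 / P) = D * (c * \<kappa>) powr (1 / 2 - 1 / P) * \<kappa> powr (1 / P)"
  proof -
    have "(P / 2 - 1) * (1 / P) = 1 / 2 - 1 / P"
      using P by (simp add: field_simps)
    then show ?thesis
      using D P by (simp add: B_def powr_mult powr_powr)
  qed
  finally show ?thesis
    by (simp add: norm_UNIV inv)
qed

text \<open>The essential supremum over the space is reached through countably many balls: those centred in
  a countable dense set.  A finite \<open>\<parallel>f\<parallel>\<^sub>\<infinity>\<close> excludes the indeterminate product \<open>0 \<cdot> \<infinity> = 0\<close> on the
  right when \<open>D\<close> or \<open>K\<close> vanishes.\<close>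

lemma Lp_bound_from_local_bounds_infinity:
  fixes f :: "real ^ 'd \<Rightarrow> 'x::euclidean_space" and g :: "real ^ 'd \<Rightarrow> 'y::euclidean_space"
  assumes f [measurable]: "f \<in> borel_measurable lebesgue"
    and g [measurable]: "g \<in> borel_measurable lebesgue"
    and fin: "Lp_norm \<infinity> UNIV f < \<infinity>" and r: "0 < r" and D: "0 \<le> D"
    and K: "0 \<le> K"
    and k [measurable]: "k \<in> borel_measurable borel"
    and mass: "(\<integral>\<^sup>+x. k (norm x) \<partial>(lborel :: (real ^ 'd) measure)) = ennreal K"
    and loc: "\<And>x. Lp_norm \<infinity> (ball x r) g
      \<le> ennreal D * ennpowr (\<integral>\<^sup>+y. k (dist x y) * ennreal ((norm (f y))\<^sup>2) \<partial>lebesgue) (1 / 2)"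
  shows "Lp_norm \<infinity> UNIV g \<le> ennreal (D * K powr (1 / 2)) * Lp_norm \<infinity> UNIV f"
proof -
  obtain a where a: "0 \<le> a" "Lp_norm \<infinity> UNIV f = ennreal a"
    using fin by (cases "Lp_norm \<infinity> UNIV f") auto
  have f_le: "AE y in lebesgue. norm (f y) \<le> a"
  proof -
    have "AE y in lebesgue. ennreal (norm (f y)) \<le> ennreal a"
      using esssup_AE[where M = lebesgue and f = "\<lambda>y. ennreal (norm (f y))"] a
      by (simp add: Lp_norm_def lebesgue_on_UNIV_eq)
    then show ?thesis
      using a(1) by (simp add: ennreal_le_iff)
  qed
  have radial [measurable]: "(\<lambda>y. k (dist x y)) \<in> borel_measurable lebesgue" for x :: "real ^ 'd"
    by (rule measurable_completion) measurable
  let ?E = "D * K powr (1 / 2) * a"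
  have ball: "Lp_norm \<infinity> (ball x r) g \<le> ennreal ?E" for x
  proof -
    have "(\<integral>\<^sup>+y. k (dist x y) * ennreal ((norm (f y))\<^sup>2) \<partial>lebesgue)
        \<le> (\<integral>\<^sup>+y. k (dist x y) * ennreal (a\<^sup>2) \<partial>lebesgue)"
    proof (rule nn_integral_mono_AE)
      show "AE y in lebesgue. k (dist x y) * ennreal ((norm (f y))\<^sup>2) \<le> k (dist x y) * ennreal (a\<^sup>2)"
        using f_le by eventually_elim (auto intro!: mult_left_mono ennreal_leI power_mono)
    qed
    also have "\<dots> = ennreal (K * a\<^sup>2)"
      using K by (simp add: nn_integral_multc ennreal_mult nn_integral_completion
          nn_integral_radial_translate mass)
    finally have "ennpowr (\<integral>\<^sup>+y. k (dist x y) * ennreal ((norm (f y))\<^sup>2) \<partial>lebesgue) (1 / 2)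
        \<le> ennpowr (ennreal (K * a\<^sup>2)) (1 / 2)"
      by (intro ennpowr_mono) auto
    also have "\<dots> = ennreal (K powr (1 / 2) * a)"
      using K a by (simp add: ennpowr_ennreal powr_half_sqrt real_sqrt_mult)
    finally have "ennreal D * ennpowr (\<integral>\<^sup>+y. k (dist x y) * ennreal ((norm (f y))\<^sup>2) \<partial>lebesgue) (1 / 2)
        \<le> ennreal D * ennreal (K powr (1 / 2) * a)"
      by (intro mult_left_mono) auto
    also have "\<dots> = ennreal ?E"
      using D by (simp add: ennreal_mult' mult.assoc)
    finally show ?thesis
      using loc order_trans by blast
  qed
  have local_AE: "AE y in lebesgue. y \<in> ball x r \<longrightarrow> norm (g y) \<le> ?E" for x
  proof -
    have "AE y in lebesgue_on (ball x r). ennreal (norm (g y)) \<le> Lp_norm \<infinity> (ball x r) g"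
      by (simp add: Lp_norm_def esssup_AE)
    then have "AE y in lebesgue_on (ball x r). norm (g y) \<le> ?E"
    proof eventually_elim
      case (elim y)
      then have "ennreal (norm (g y)) \<le> ennreal ?E"
        using ball[of x] by order
      then show ?case
        using D K a by (subst (asm) ennreal_le_iff) auto
    qed
    then show ?thesis
      by (subst (asm) AE_restrict_space_iff) auto
  qed
  obtain Q :: "(real ^ 'd) set" where Q: "countable Q"
    "\<And>U. open U \<Longrightarrow> U \<noteq> {} \<Longrightarrow> \<exists>q\<in>Q. q \<in> U"
    by (rule countable_dense_setE) auto
  have "AE y in lebesgue. \<forall>x\<in>Q. y \<in> ball x r \<longrightarrow> norm (g y) \<le> ?E"
    unfolding AE_ball_countable[OF Q(1)] using local_AE by blast
  then have "AE y in lebesgue. ennreal (norm (g y)) \<le> ennreal ?E"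
  proof eventually_elim
    case (elim y)
    obtain x where "x \<in> Q" "x \<in> ball y r"
      using Q(2)[of "ball y r"] r by auto
    with elim have "norm (g y) \<le> ?E"
      by (auto simp: dist_commute)
    then show ?case
      by (rule ennreal_leI)
  qed
  then have "esssup lebesgue (\<lambda>y. ennreal (norm (g y))) \<le> ennreal ?E"
    by (intro esssup_I) auto
  then show ?thesis
    using a D by (simp add: Lp_norm_def lebesgue_on_UNIV_eq ennreal_mult')
qed

section \<open>Uniform boundedness\<close>

theorem proposition4p3:
  fixes \<Omega> :: "complex set"
    and V :: "(real ^ 'd \<Rightarrow> 'x::complex_euclidean_space) set"
    and W :: "(real ^ 'd \<Rightarrow> 'y::complex_euclidean_space) set"
    and T :: "complex \<Rightarrow> (real ^ 'd \<Rightarrow> 'x) \<Rightarrow> (real ^ 'd \<Rightarrow> 'y)"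
    and \<nu> :: real and p :: ennreal
  assumes dim: "2 \<le> CARD('d)"
    and Omega: "open \<Omega>" "0 \<notin> \<Omega>"
    and V: "closed_L2_subspace V"
    and W: "closed_L2_subspace W"
    and T: "\<And>z. z \<in> \<Omega> \<Longrightarrow> T z \<in> bounded_operators V W"
    and p: "2 \<le> p"
    and nu: "real CARD('d) < \<nu>"
    and decay: "L2_Lp_decay_estimates \<nu> p \<Omega> V T"
  shows "\<exists>C::real. 0 < C \<and>
    (\<forall>z\<in>\<Omega>. \<forall>f\<in>V \<inter> Lp_space p. Lp_norm p UNIV (T z f) \<le> ennreal C * Lp_norm p UNIV f)"
proof -
  obtain M N C where C: "0 < C" and est: "\<And>z x r f. z \<in> \<Omega> \<Longrightarrow> 0 < r \<Longrightarrow> f \<in> V \<Longrightarrow>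
      Lp_norm p (ball x r) (T z f) \<le>
        ennreal (C * r powr (- real CARD('d) * (1 / 2 - enn2real (inverse p)))
          * max ((r\<^sup>2 / cmod z) powr M) ((r\<^sup>2 / cmod z) powr (- N)))
        * ennpowr (\<Sum>n. ennreal (2 powr (- \<nu> * real n)) * (Lp_norm 2 (dyadic_annulus n x r) f)\<^sup>2) (1 / 2)"
    using decay unfolding L2_Lp_decay_estimates_def by (elim exE conjE) blast
  define s where "s = enn2real (inverse p)"
  define v where "v = unit_ball_vol (real CARD('d))"
  define \<kappa> where "\<kappa> = 1 / (1 - 2 powr (real CARD('d) - \<nu>))"
  have v: "0 < v"
    by (simp add: v_def)
  have \<kappa>: "0 < \<kappa>"
    using powr_less_cancel_iff[of 2 "real CARD('d) - \<nu>" 0] nu by (simp add: \<kappa>_def)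
  define C' where "C' = C * (v * \<kappa>) powr (1 / 2 - s) * \<kappa> powr s"
  have "Lp_norm p UNIV (T z f) \<le> ennreal C' * Lp_norm p UNIV f"
    if z: "z \<in> \<Omega>" and f: "f \<in> V \<inter> Lp_space p" for z f
  proof -
    \<comment> \<open>The parabolic scale, at which both powers of \<open>r\<^sup>2 / |z|\<close> are \<open>1\<close>.\<close>
    define r where "r = sqrt (cmod z)"
    define D where "D = C * r powr (- real CARD('d) * (1 / 2 - s))"
    define c where "c = v * r ^ CARD('d)"
    have "z \<noteq> 0"
      using z Omega by auto
    then have r: "0 < r" "r\<^sup>2 / cmod z = 1"
      by (simp_all add: r_def)
    have c: "0 < c" and D: "0 \<le> D"
      using v r C by (simp_all add: c_def D_def)
    have f_meas: "f \<in> borel_measurable lebesgue" and f_fin: "Lp_norm p UNIV f < \<infinity>"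
      using f by (auto simp: Lp_space_def)
    have Tf_meas: "T z f \<in> borel_measurable lebesgue"
      using T[OF z] f W by (auto simp: bounded_operators_def closed_L2_subspace_def Lp_space_def)
    have vol: "emeasure lborel (ball (0 :: real ^ 'd) r) = ennreal c"
      using r by (simp add: emeasure_ball c_def v_def)
    have mass: "(\<integral>\<^sup>+x. decay_kernel \<nu> r (norm x) \<partial>(lborel :: (real ^ 'd) measure)) = ennreal (c * \<kappa>)"
      using nn_integral_decay_kernel[where 'a = "real ^ 'd"] nu r by (simp add: c_def v_def \<kappa>_def)
    have loc: "Lp_norm p (ball x r) (T z f) \<le> ennreal D *
        ennpowr (\<integral>\<^sup>+y. decay_kernel \<nu> r (dist x y) * ennreal ((norm (f y))\<^sup>2) \<partial>lebesgue) (1 / 2)" for x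
    proof -
      have "Lp_norm p (ball x r) (T z f) \<le> ennreal D *
          ennpowr (\<Sum>n. ennreal (2 powr (- \<nu> * real n)) * (Lp_norm 2 (dyadic_annulus n x r) f)\<^sup>2) (1 / 2)"
        using est[OF z r(1), of f x] f unfolding r(2) by (simp add: D_def s_def)
      also have "\<dots> \<le> ennreal D *
          ennpowr (\<integral>\<^sup>+y. decay_kernel \<nu> r (dist x y) * ennreal ((norm (f y))\<^sup>2) \<partial>lebesgue) (1 / 2)"
        using sum_dyadic_annuli_le_decay_kernel[OF f_meas]
        by (intro mult_left_mono ennpowr_mono) auto
      finally show ?thesis .
    qed
    \<comment> \<open>Scale invariance: the powers of \<open>r\<close> cancel.\<close>
    have const: "D * (c * \<kappa>) powr (1 / 2 - s) = C * (v * \<kappa>) powr (1 / 2 - s)"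
    proof -
      have "(c * \<kappa>) powr (1 / 2 - s) = (v * \<kappa>) powr (1 / 2 - s) * (r powr real CARD('d)) powr (1 / 2 - s)"
        using r v \<kappa> by (simp add: c_def powr_mult powr_realpow mult_ac)
      moreover have "(r powr real CARD('d)) powr (1 / 2 - s) * r powr (- real CARD('d) * (1 / 2 - s)) = 1"
        using r by (simp add: powr_powr flip: powr_add)
      ultimately show ?thesis
        by (simp add: D_def mult_ac)
    qed
    show ?thesis
    proof (cases "p = \<infinity>")
      case True
      then have "s = 0"
        by (simp add: s_def)
      then have "C' = D * (c * \<kappa>) powr (1 / 2)"
        using const \<kappa> by (simp add: C'_def)
      with True show ?thesis
        using Lp_bound_from_local_bounds_infinity[OF f_meas Tf_meas _ r(1) D _ decay_kernel_measurable mass]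
          f_fin loc c \<kappa> by simp
    next
      case False
      then show ?thesis
        using Lp_bound_from_local_bounds_finite[OF f_meas Tf_meas p _ D c \<kappa>
            decay_kernel_measurable vol mass loc] const
        by (simp add: C'_def s_def)
    qed
  qed
  moreover have "0 < C'"
    using C v \<kappa> by (simp add: C'_def)
  ultimately show ?thesis
    by blast
qed

end
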